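(* The maximal order on the universal covering $H$ of ${\rm Homeo}^+(S^1)$ with respect to the translation number is given by $$g\ge h\ \Leftrightarrow\ \forall x\in\mathbb{R}:\ g.x\ge h.x\qquad(g,h\in H).$$
   Context: ${\rm Homeo}^+(S^1)$ is the group of orientation-preserving homeomorphisms of the circle with the compact-open topology; its universal covering is $H=\{f\in{\rm Homeo}(\mathbb{R})\mid f\text{ increasing},\ f(x+1)=f(x)+1\}$. The translation number is the continuous function $T:H\to\mathbb{R}$, $T(g)=\lim_{n\to\infty}\frac{g^n.x-x}{n}$ (independent of $x\in\mathbb{R}$). It is an aperiodic homogeneous quasimorphism, meaning: $\sup_{g,h}|T(gh)-T(g)-T(h)|<\infty$, $T(g^n)=nT(g)$ for all $n\in\mathbb{Z}$, and the only normal subgroup of $H$ on which $T$ vanishes is trivial. A bi-invariant partial order on $H$ (one preserved by left and right translations) is sandwiched by $T$ if its order semigroup $H^+=\{g\mid g\ge e\}$ satisfies $\{g\mid T(g)\ge C_1\}\subset H^+\subset\{g\mid T(g)\ge C_2\}$ for some $C_1,C_2\in\mathbb{R}$. The maximal order with respect to $T$ is the unique bi-invariant partial order sandwiched by $T$ whose order semigroup is maximal under inclusion; its order semigroup is $\{g\in H\mid\forall h\in H:\ T(gh)\ge T(h)\}$. *)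

theory Defs
  imports "HOL-Analysis.Analysis" "HOL-Algebra.Group"
begin

definition homeo_cover :: "(real \<Rightarrow> real) monoid" where
  "homeo_cover =
     \<lparr>carrier = {f. (\<exists>f'. homeomorphism UNIV UNIV f f') \<and> strict_mono f \<and> (\<forall>x. f (x + 1) = f x + 1)},
      mult = (\<circ>), one = id\<rparr>"

text \<open>The description operator expresses that the limit does not depend on the base point.\<close>

definition translation_number :: "(real \<Rightarrow> real) \<Rightarrow> real" where
  "translation_number g = (THE t. \<forall>x. (\<lambda>n. ((g ^^ n) x - x) / real n) \<longlonglongrightarrow> t)"

text \<open>As in \<open>HOL.Order_Relation\<close>, a pair \<open>(a, b)\<close> in an order relation means \<open>a \<le> b\<close>.\<close>

definition biinvariant_order :: "('a, 'b) monoid_scheme \<Rightarrow> 'a rel \<Rightarrow> bool" where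
  "biinvariant_order G r \<longleftrightarrow>
     partial_order_on (carrier G) r \<and>
     (\<forall>(a, b) \<in> r. \<forall>c \<in> carrier G.
        (c \<otimes>\<^bsub>G\<^esub> a, c \<otimes>\<^bsub>G\<^esub> b) \<in> r \<and> (a \<otimes>\<^bsub>G\<^esub> c, b \<otimes>\<^bsub>G\<^esub> c) \<in> r)"

definition order_semigroup :: "('a, 'b) monoid_scheme \<Rightarrow> 'a rel \<Rightarrow> 'a set" where
  "order_semigroup G r = {g \<in> carrier G. (\<one>\<^bsub>G\<^esub>, g) \<in> r}"

definition sandwiched_order :: "('a, 'b) monoid_scheme \<Rightarrow> ('a \<Rightarrow> real) \<Rightarrow> 'a rel \<Rightarrow> bool" where
  "sandwiched_order G T r \<longleftrightarrow>
     biinvariant_order G r \<and>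
     (\<exists>C1 C2. {g \<in> carrier G. T g \<ge> C1} \<subseteq> order_semigroup G r \<and>
              order_semigroup G r \<subseteq> {g \<in> carrier G. T g \<ge> C2})"

definition maximal_order :: "('a, 'b) monoid_scheme \<Rightarrow> ('a \<Rightarrow> real) \<Rightarrow> 'a rel \<Rightarrow> bool" where
  "maximal_order G T r \<longleftrightarrow>
     sandwiched_order G T r \<and>
     (\<forall>r'. sandwiched_order G T r' \<and> order_semigroup G r \<subseteq> order_semigroup G r' \<longrightarrow>
           order_semigroup G r' = order_semigroup G r)"

lemma group_homeo_cover: "group homeo_cover"
proof (rule groupI)
  fix f assume f: "f \<in> carrier homeo_cover"
  then obtain g where h: "homeomorphism UNIV UNIV f g" by (auto simp: homeo_cover_def)
  have m: "strict_mono f" and p: "\<And>x. f (x + 1) = f x + 1"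
    using f by (auto simp: homeo_cover_def)
  have fg: "f (g x) = x" and gf: "g (f x) = x" for x
    using h by (auto simp: homeomorphism_def)
  have "strict_mono g"
    by (rule strict_monoI) (metis fg m strict_mono_less)
  moreover have "g (x + 1) = g x + 1" for x
    by (metis fg gf p)
  moreover have "homeomorphism UNIV UNIV g f"
    using h by (rule homeomorphism_symD)
  ultimately show "\<exists>y\<in>carrier homeo_cover. y \<otimes>\<^bsub>homeo_cover\<^esub> f = \<one>\<^bsub>homeo_cover\<^esub>"
    by (intro bexI[of _ g]) (auto simp: homeo_cover_def gf)
next
  fix f g assume "f \<in> carrier homeo_cover" "g \<in> carrier homeo_cover"
  then show "f \<otimes>\<^bsub>homeo_cover\<^esub> g \<in> carrier homeo_cover"
    by (auto simp: homeo_cover_def strict_mono_def intro: homeomorphism_compose)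
next
  show "\<one>\<^bsub>homeo_cover\<^esub> \<in> carrier homeo_cover"
    by (auto simp: homeo_cover_def strict_mono_def id_def intro!: exI[of _ id] homeomorphismI)
qed (auto simp: homeo_cover_def)

end

theory Submission
  imports Defs
begin

text \<open>
  Write \<open>H\<close> for the group \<open>homeo_cover\<close> and \<open>T\<close> for the translation number. An increasing map
  commuting with \<open>x \<mapsto> x + 1\<close> moves all points by the same amount, up to an error of at most 1
  (\<open>displacement_diff_le_1\<close>). Applied to the iterates of \<open>g\<close>, this makes the mean displacements
  \<open>(g\<^sup>n x - x) / n\<close> a Cauchy sequence, so that \<open>T g\<close> exists, and it gives the single estimate that
  the rest relies on: \<open>\<bar>T g - (g x - x)\<bar> \<le> 1\<close> for all \<open>x\<close> (\<open>translation_number_near_displacement\<close>).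

  By this estimate, \<open>T g \<ge> 1\<close> forces \<open>g x \<ge> x\<close> everywhere, and the latter forces \<open>T g \<ge> -1\<close>:
  the pointwise order is sandwiched. Conversely, the order semigroup of any sandwiched order lies
  in that of the pointwise order (\<open>order_semigroup_le_pointwise\<close>). Suppose indeed that \<open>g \<ge> e\<close> but
  \<open>g x = x - d\<close> with \<open>d > 0\<close> at some point \<open>x\<close>. The order semigroup contains all conjugates of \<open>g\<close>;
  the conjugate by the translation by \<open>-k d\<close> moves \<open>x - k d\<close> to \<open>x - (k + 1) d\<close>. Composing these
  conjugates for \<open>k < n\<close> yields a positive element that moves \<open>x\<close> to \<open>x - n d\<close>, so its translation
  number is at most \<open>1 - n d\<close>. Hence \<open>T\<close> is not bounded below on the order semigroup.

  So the pointwise order is the greatest sandwiched order, not just a maximal one. Since a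
  bi-invariant order is determined by its order semigroup, it is the only maximal one.
\<close>

section \<open>Bi-invariant orders and their order semigroups\<close>

lemma order_semigroup_mult_closed:
  assumes "group G" "biinvariant_order G r"
    and a: "a \<in> order_semigroup G r" and b: "b \<in> order_semigroup G r"
  shows "a \<otimes>\<^bsub>G\<^esub> b \<in> order_semigroup G r"
proof -
  interpret group G by fact
  have ac: "a \<in> carrier G" and ar: "(\<one>\<^bsub>G\<^esub>, a) \<in> r"
    and bc: "b \<in> carrier G" and br: "(\<one>\<^bsub>G\<^esub>, b) \<in> r"
    using a b by (auto simp: order_semigroup_def)
  have "(a \<otimes>\<^bsub>G\<^esub> \<one>\<^bsub>G\<^esub>, a \<otimes>\<^bsub>G\<^esub> b) \<in> r"
    using assms(2) br ac by (auto simp: biinvariant_order_def)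
  moreover have "trans r"
    using assms(2) by (auto simp: biinvariant_order_def dest: partial_order_onD)
  ultimately have "(\<one>\<^bsub>G\<^esub>, a \<otimes>\<^bsub>G\<^esub> b) \<in> r"
    using ar ac by (auto elim: transE)
  then show ?thesis
    using ac bc by (simp add: order_semigroup_def)
qed

lemma order_semigroup_conjugation_closed:
  assumes "group G" "biinvariant_order G r"
    and a: "a \<in> order_semigroup G r" and c: "c \<in> carrier G"
  shows "c \<otimes>\<^bsub>G\<^esub> a \<otimes>\<^bsub>G\<^esub> inv\<^bsub>G\<^esub> c \<in> order_semigroup G r"
proof -
  interpret group G by fact
  have ac: "a \<in> carrier G" and ar: "(\<one>\<^bsub>G\<^esub>, a) \<in> r"
    using a by (auto simp: order_semigroup_def)
  have "(c \<otimes>\<^bsub>G\<^esub> \<one>\<^bsub>G\<^esub>, c \<otimes>\<^bsub>G\<^esub> a) \<in> r"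
    using assms(2) ar c by (auto simp: biinvariant_order_def)
  then have "(c \<otimes>\<^bsub>G\<^esub> \<one>\<^bsub>G\<^esub> \<otimes>\<^bsub>G\<^esub> inv\<^bsub>G\<^esub> c, c \<otimes>\<^bsub>G\<^esub> a \<otimes>\<^bsub>G\<^esub> inv\<^bsub>G\<^esub> c) \<in> r"
    using assms(2) inv_closed[OF c] unfolding biinvariant_order_def by blast
  then show ?thesis
    using ac c by (simp add: order_semigroup_def)
qed

lemma biinvariant_order_le_iff:
  assumes "group G" "biinvariant_order G r"
  shows "(a, b) \<in> r \<longleftrightarrow>
    a \<in> carrier G \<and> b \<in> carrier G \<and> b \<otimes>\<^bsub>G\<^esub> inv\<^bsub>G\<^esub> a \<in> order_semigroup G r"
proof -
  interpret group G by fact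
  have sub: "r \<subseteq> carrier G \<times> carrier G"
    using assms(2) by (auto simp: biinvariant_order_def dest: partial_order_onD)
  have right: "(x \<otimes>\<^bsub>G\<^esub> c, y \<otimes>\<^bsub>G\<^esub> c) \<in> r" if "(x, y) \<in> r" "c \<in> carrier G" for x y c
    using assms(2) that unfolding biinvariant_order_def by blast
  show ?thesis
  proof
    assume ab: "(a, b) \<in> r"
    then have "a \<in> carrier G" "b \<in> carrier G"
      using sub by auto
    moreover have "(a \<otimes>\<^bsub>G\<^esub> inv\<^bsub>G\<^esub> a, b \<otimes>\<^bsub>G\<^esub> inv\<^bsub>G\<^esub> a) \<in> r"
      using right[OF ab inv_closed] \<open>a \<in> carrier G\<close> by blast
    ultimately show "a \<in> carrier G \<and> b \<in> carrier G \<and> b \<otimes>\<^bsub>G\<^esub> inv\<^bsub>G\<^esub> a \<in> order_semigroup G r"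
      by (simp add: order_semigroup_def r_inv)
  next
    assume *: "a \<in> carrier G \<and> b \<in> carrier G \<and> b \<otimes>\<^bsub>G\<^esub> inv\<^bsub>G\<^esub> a \<in> order_semigroup G r"
    then have "(\<one>\<^bsub>G\<^esub> \<otimes>\<^bsub>G\<^esub> a, b \<otimes>\<^bsub>G\<^esub> inv\<^bsub>G\<^esub> a \<otimes>\<^bsub>G\<^esub> a) \<in> r"
      by (intro right) (auto simp: order_semigroup_def)
    then show "(a, b) \<in> r"
      using * by (simp add: m_assoc)
  qed
qed

lemma biinvariant_order_eqI:
  assumes "group G" "biinvariant_order G r" "biinvariant_order G s"
    and "order_semigroup G r = order_semigroup G s"
  shows "r = s"
  using assms(4) biinvariant_order_le_iff[OF assms(1,2)] biinvariant_order_le_iff[OF assms(1,3)]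
  by auto

section \<open>Displacements and the translation number\<close>

lemma homeo_coverD:
  assumes "f \<in> carrier homeo_cover"
  shows "strict_mono f" "f (x + 1) = f x + 1"
  using assms by (auto simp: homeo_cover_def)

lemma homeo_cover_simps:
  "f \<otimes>\<^bsub>homeo_cover\<^esub> g = f \<circ> g" "\<one>\<^bsub>homeo_cover\<^esub> = id"
  by (simp_all add: homeo_cover_def)

lemma homeo_cover_comp_closed:
  assumes "f \<in> carrier homeo_cover" "g \<in> carrier homeo_cover"
  shows "f \<circ> g \<in> carrier homeo_cover"
proof -
  interpret group homeo_cover by (rule group_homeo_cover)
  show ?thesis
    using m_closed[OF assms] by (simp add: homeo_cover_simps)
qed

lemma homeo_cover_id_closed: "id \<in> carrier homeo_cover"
proof -
  interpret group homeo_cover by (rule group_homeo_cover)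
  show ?thesis
    using one_closed by (simp add: homeo_cover_simps)
qed

lemma homeo_cover_funpow_closed:
  assumes "f \<in> carrier homeo_cover"
  shows "f ^^ n \<in> carrier homeo_cover"
  using homeo_cover_comp_closed[OF assms] homeo_cover_id_closed
  by (induction n) (simp_all add: comp_def id_def)

lemma homeo_cover_shift_int:
  assumes "f \<in> carrier homeo_cover"
  shows "f (x + of_int k) = f x + of_int k"
proof (induction k rule: int_induct[where k = 0])
  case base
  show ?case by simp
next
  case (step1 i)
  then show ?case
    using homeo_coverD(2)[OF assms, of "x + of_int i"] by (simp add: add.assoc)
next
  case (step2 i)
  then show ?case
    using homeo_coverD(2)[OF assms, of "x + of_int (i - 1)"] by simp
qed

text \<open>The displacement is a periodic function, so \<open>y\<close> may be moved into \<open>[x, x + 1)\<close>; there both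
  \<open>f y\<close> and \<open>y\<close> vary within an interval of length 1.\<close>

lemma displacement_diff_le_1:
  assumes "f \<in> carrier homeo_cover"
  shows "\<bar>(f y - y) - (f x - x)\<bar> \<le> 1"
proof -
  define k where "k = - \<lfloor>y - x\<rfloor>"
  define z where "z = y + of_int k"
  have z: "x \<le> z" "z < x + 1"
    unfolding z_def k_def by linarith+
  have "f x \<le> f z" "f z \<le> f x + 1"
    using z strict_mono_less_eq[OF homeo_coverD(1)[OF assms]] homeo_coverD(2)[OF assms, of x]
    by (metis, metis less_imp_le)
  moreover have "f z - z = f y - y"
    by (simp add: z_def homeo_cover_shift_int[OF assms])
  ultimately show ?thesis
    using z by linarith
qed

text \<open>The displacement of \<open>f\<^sup>m\<^sup>n\<close> at \<open>x\<close> is the sum of the displacements of \<open>f\<^sup>m\<close> at \<open>n\<close> points of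
  the orbit of \<open>x\<close>, and each of these differs by at most 1 from the one at \<open>x\<close>.\<close>

lemma displacement_funpow_mult:
  assumes "f \<in> carrier homeo_cover"
  shows "\<bar>((f ^^ (m * n)) x - x) - real n * ((f ^^ m) x - x)\<bar> \<le> real n"
proof (induction n)
  case 0
  show ?case by simp
next
  case (Suc n)
  let ?z = "(f ^^ (m * n)) x"
  have "(f ^^ (m * Suc n)) x = (f ^^ m) ?z"
    by (simp add: funpow_add)
  moreover have "\<bar>((f ^^ m) ?z - ?z) - ((f ^^ m) x - x)\<bar> \<le> 1"
    by (rule displacement_diff_le_1[OF homeo_cover_funpow_closed[OF assms]])
  ultimately show ?case
    using Suc.IH by (simp add: algebra_simps abs_le_iff)
qed

text \<open>Compare the mean displacements after \<open>m\<close> and after \<open>n\<close> steps with the one after \<open>m n\<close> steps.\<close>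

lemma mean_displacement_diff:
  assumes "f \<in> carrier homeo_cover" and m: "m > 0" and n: "n > 0"
  shows "\<bar>((f ^^ m) x - x) / real m - ((f ^^ n) x - x) / real n\<bar> \<le> 1 / real m + 1 / real n"
proof -
  have *: "\<bar>((f ^^ (i * j)) x - x) / real (i * j) - ((f ^^ i) x - x) / real i\<bar> \<le> 1 / real i"
    if "i > 0" "j > 0" for i j
  proof -
    have "((f ^^ (i * j)) x - x) / real (i * j) - ((f ^^ i) x - x) / real i
        = (((f ^^ (i * j)) x - x) - real j * ((f ^^ i) x - x)) / real (i * j)"
      using that by (simp add: field_simps)
    also have "\<bar>\<dots>\<bar> \<le> real j / real (i * j)"
      unfolding abs_divide abs_of_nat
      by (intro divide_right_mono displacement_funpow_mult[OF assms(1)]) simp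
    also have "\<dots> = 1 / real i"
      using that by simp
    finally show ?thesis .
  qed
  show ?thesis
    using *[OF m n] *[OF n m] by (simp add: mult.commute[of n m] abs_le_iff)
qed

lemma mean_displacement_convergent:
  assumes "f \<in> carrier homeo_cover"
  shows "convergent (\<lambda>n. ((f ^^ n) x - x) / real n)"
proof -
  have "Cauchy (\<lambda>n. ((f ^^ n) x - x) / real n)"
  proof (rule metric_CauchyI)
    fix e :: real assume "e > 0"
    then obtain N where N: "N > 0" "1 / real N < e / 2"
      by (metis half_gt_zero nat_approx_posE zero_less_Suc)
    have "dist (((f ^^ m) x - x) / real m) (((f ^^ n) x - x) / real n) < e"
      if "m \<ge> N" "n \<ge> N" for m n
    proof -
      have "1 / real m \<le> 1 / real N" "1 / real n \<le> 1 / real N"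
        using that N(1) by (auto intro!: divide_left_mono)
      moreover have "m > 0" "n > 0"
        using that N(1) by auto
      ultimately show ?thesis
        using mean_displacement_diff[OF assms, of m n x] N(2) unfolding dist_real_def by linarith
    qed
    then show "\<exists>M. \<forall>m\<ge>M. \<forall>n\<ge>M.
        dist (((f ^^ m) x - x) / real m) (((f ^^ n) x - x) / real n) < e"
      by blast
  qed
  then show ?thesis
    by (simp add: Cauchy_convergent_iff)
qed

lemma translation_number_LIMSEQ:
  assumes "f \<in> carrier homeo_cover"
  shows "(\<lambda>n. ((f ^^ n) x - x) / real n) \<longlonglongrightarrow> translation_number f"
proof -
  obtain t where t: "(\<lambda>n. ((f ^^ n) 0 - 0) / real n) \<longlonglongrightarrow> t"
    using mean_displacement_convergent[OF assms, of 0] by (auto simp: convergent_def)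
  have lim: "(\<lambda>n. ((f ^^ n) y - y) / real n) \<longlonglongrightarrow> t" for y
  proof (rule Lim_transform[OF t])
    have "\<bar>((f ^^ n) 0 - 0) / real n - ((f ^^ n) y - y) / real n\<bar> \<le> 1 / real n" for n
      using displacement_diff_le_1[OF homeo_cover_funpow_closed[OF assms], of n 0 y]
      unfolding diff_divide_distrib[symmetric] abs_divide by (simp add: divide_right_mono)
    then have "(\<lambda>n. ((f ^^ n) 0 - 0) / real n - ((f ^^ n) y - y) / real n) \<longlonglongrightarrow> 0"
      by (intro Lim_null_comparison[OF _ lim_1_over_n]) simp
    from tendsto_minus[OF this]
    show "(\<lambda>n. ((f ^^ n) y - y) / real n - ((f ^^ n) 0 - 0) / real n) \<longlonglongrightarrow> 0"
      by simp
  qed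
  have "translation_number f = t"
    unfolding translation_number_def
    by (rule the_equality) (use lim in \<open>auto intro: LIMSEQ_unique\<close>)
  then show ?thesis
    using lim by simp
qed

text \<open>The case \<open>m = 1\<close> of \<open>displacement_funpow_mult\<close>, divided by \<open>n\<close>, in the limit.\<close>

lemma translation_number_near_displacement:
  assumes "f \<in> carrier homeo_cover"
  shows "\<bar>translation_number f - (f x - x)\<bar> \<le> 1"
proof (rule LIMSEQ_le_const2)
  show "(\<lambda>n. \<bar>((f ^^ n) x - x) / real n - (f x - x)\<bar>) \<longlonglongrightarrow> \<bar>translation_number f - (f x - x)\<bar>"
    by (intro tendsto_intros translation_number_LIMSEQ assms)
  have "\<bar>((f ^^ n) x - x) / real n - (f x - x)\<bar> \<le> 1" if "n \<ge> 1" for n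
  proof -
    have "((f ^^ n) x - x) / real n - (f x - x)
        = (((f ^^ (1 * n)) x - x) - real n * ((f ^^ 1) x - x)) / real n"
      using that by (simp add: field_simps)
    also have "\<bar>\<dots>\<bar> \<le> real n / real n"
      unfolding abs_divide
      using displacement_funpow_mult[OF assms, of 1 n x] by (simp add: divide_right_mono)
    finally show ?thesis
      using that by simp
  qed
  then show "\<exists>N. \<forall>n\<ge>N. \<bar>((f ^^ n) x - x) / real n - (f x - x)\<bar> \<le> 1"
    by blast
qed

section \<open>The pointwise order\<close>

definition pointwise_order :: "(real \<Rightarrow> real) rel" where
  "pointwise_order =
     {(h, g). h \<in> carrier homeo_cover \<and> g \<in> carrier homeo_cover \<and> (\<forall>x. g x \<ge> h x)}"

lemma order_semigroup_pointwise_order: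
  "order_semigroup homeo_cover pointwise_order = {g \<in> carrier homeo_cover. \<forall>x. x \<le> g x}"
  by (auto simp: order_semigroup_def pointwise_order_def homeo_cover_simps homeo_cover_id_closed)

lemma biinvariant_pointwise_order: "biinvariant_order homeo_cover pointwise_order"
proof -
  have "antisym pointwise_order"
    unfolding pointwise_order_def le_fun_def[symmetric] by (auto intro!: antisymI)
  then have "partial_order_on (carrier homeo_cover) pointwise_order"
    unfolding partial_order_on_def preorder_on_def pointwise_order_def
    by (auto simp: refl_on_def intro!: transI intro: order_trans)
  moreover have "c (a x) \<le> c (b x)"
    if "c \<in> carrier homeo_cover" "\<forall>x. a x \<le> b x" for a b c :: "real \<Rightarrow> real" and x
    using that strict_mono_less_eq[OF homeo_coverD(1)] by blast
  ultimately show ?thesis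
    by (auto simp: biinvariant_order_def pointwise_order_def homeo_cover_simps
        homeo_cover_comp_closed)
qed

lemma sandwiched_pointwise_order:
  "sandwiched_order homeo_cover translation_number pointwise_order"
proof -
  have "x \<le> g x" if "g \<in> carrier homeo_cover" "translation_number g \<ge> 1" for g x
    using translation_number_near_displacement[OF that(1), of x] that(2) by linarith
  moreover have "translation_number g \<ge> -1" if "g \<in> carrier homeo_cover" "\<forall>x. x \<le> g x" for g
    using translation_number_near_displacement[OF that(1), of 0] that(2)[rule_format, of 0]
    by linarith
  ultimately show ?thesis
    unfolding sandwiched_order_def order_semigroup_pointwise_order
    by (intro conjI biinvariant_pointwise_order exI[of _ 1] exI[of _ "-1"]) auto
qed

section \<open>Every sandwiched order is contained in the pointwise order\<close>

lemma translation_in_homeo_cover: "(\<lambda>x. x + c) \<in> carrier homeo_cover"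
proof -
  have "homeomorphism UNIV UNIV (\<lambda>x. x + c) (\<lambda>x. x - c)"
    by (rule homeomorphismI) (auto intro!: continuous_intros)
  then show ?thesis
    by (auto simp: homeo_cover_def strict_mono_def)
qed

lemma inv_translation_homeo_cover:
  "inv\<^bsub>homeo_cover\<^esub> (\<lambda>x. x + c) = (\<lambda>x. x - c)"
proof -
  interpret group homeo_cover by (rule group_homeo_cover)
  have "(\<lambda>x. x - c) = (\<lambda>x. x + - c)"
    by simp
  then show ?thesis
    using translation_in_homeo_cover[of "- c"] translation_in_homeo_cover[of c]
    by (intro inv_equality) (auto simp: homeo_cover_simps)
qed

text \<open>If a positive element moves \<open>x\<close> down at all, then products of its conjugates by translations,
  which are positive too, move \<open>x\<close> down arbitrarily far.\<close>

lemma order_semigroup_multiple_displacement: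
  assumes "biinvariant_order homeo_cover r" "g \<in> order_semigroup homeo_cover r"
  shows "\<exists>f \<in> order_semigroup homeo_cover r. f x - x = real (Suc n) * (g x - x)"
proof (induction n)
  case 0
  show ?case
    using assms(2) by auto
next
  case (Suc n)
  then obtain f where f: "f \<in> order_semigroup homeo_cover r"
    and fx: "f x - x = real (Suc n) * (g x - x)"
    by blast
  \<comment> \<open>the translation that moves \<open>x\<close> to \<open>f x\<close>\<close>
  define c where "c = f x - x"
  define g' where "g' = (\<lambda>y. g (y - c) + c)"
  have "g' = (\<lambda>y. y + c) \<otimes>\<^bsub>homeo_cover\<^esub> g \<otimes>\<^bsub>homeo_cover\<^esub> inv\<^bsub>homeo_cover\<^esub> (\<lambda>y. y + c)"
    by (auto simp: g'_def inv_translation_homeo_cover homeo_cover_simps)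
  then have "g' \<in> order_semigroup homeo_cover r"
    using order_semigroup_conjugation_closed[OF group_homeo_cover assms translation_in_homeo_cover]
    by simp
  then have "g' \<circ> f \<in> order_semigroup homeo_cover r"
    using order_semigroup_mult_closed[OF group_homeo_cover assms(1) _ f]
    by (simp add: homeo_cover_simps)
  moreover have "(g' \<circ> f) x - x = real (Suc (Suc n)) * (g x - x)"
    using fx by (simp add: g'_def c_def algebra_simps)
  ultimately show ?case
    by blast
qed

lemma order_semigroup_le_pointwise:
  assumes "biinvariant_order homeo_cover r"
    and bound: "order_semigroup homeo_cover r \<subseteq> {g \<in> carrier homeo_cover. translation_number g \<ge> C}"
  shows "order_semigroup homeo_cover r \<subseteq> order_semigroup homeo_cover pointwise_order"
proof
  fix g assume g: "g \<in> order_semigroup homeo_cover r"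
  have "x \<le> g x" for x
  proof (rule ccontr)
    assume "\<not> x \<le> g x"
    then have "0 < x - g x" by simp
    then obtain n where n: "1 - C < real n * (x - g x)"
      using reals_Archimedean3 by blast
    obtain f where f: "f \<in> order_semigroup homeo_cover r"
      and fx: "f x - x = real (Suc n) * (g x - x)"
      using order_semigroup_multiple_displacement[OF assms(1) g] by blast
    have "f \<in> carrier homeo_cover" "C \<le> translation_number f"
      using bound f by auto
    then have "C - 1 \<le> f x - x"
      using translation_number_near_displacement[of f x] by linarith
    also have "f x - x < C - 1"
      using n \<open>0 < x - g x\<close> unfolding fx by (simp add: algebra_simps)
    finally show False by simp
  qed
  moreover have "g \<in> carrier homeo_cover"
    using g by (simp add: order_semigroup_def)
  ultimately show "g \<in> order_semigroup homeo_cover pointwise_order"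
    by (simp add: order_semigroup_pointwise_order)
qed

theorem corollary2p19:
  fixes r :: "(real \<Rightarrow> real) rel"
  shows "maximal_order homeo_cover translation_number r \<longleftrightarrow>
    r = {(h, g). h \<in> carrier homeo_cover \<and> g \<in> carrier homeo_cover \<and> (\<forall>x. g x \<ge> h x)}"
proof -
  have greatest: "order_semigroup homeo_cover s \<subseteq> order_semigroup homeo_cover pointwise_order"
    if "sandwiched_order homeo_cover translation_number s" for s
    using that order_semigroup_le_pointwise unfolding sandwiched_order_def by blast
  have "maximal_order homeo_cover translation_number r \<longleftrightarrow> r = pointwise_order"
  proof
    assume r: "maximal_order homeo_cover translation_number r"
    then have "order_semigroup homeo_cover r = order_semigroup homeo_cover pointwise_order"
      using greatest sandwiched_pointwise_order unfolding maximal_order_def by blast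
    with r show "r = pointwise_order"
      by (intro biinvariant_order_eqI[OF group_homeo_cover])
        (auto simp: maximal_order_def sandwiched_order_def biinvariant_pointwise_order)
  next
    assume "r = pointwise_order"
    then show "maximal_order homeo_cover translation_number r"
      using greatest sandwiched_pointwise_order unfolding maximal_order_def by blast
  qed
  then show ?thesis
    by (simp only: pointwise_order_def)
qed

end
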